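(* Let $\mathbf{Y}=(\mathbf{Y}^1,\dots,\mathbf{Y}^n)$ be a sample of i.i.d. integrable random vectors in $\mathbb{R}^K$ with mean $\mu$, whose distribution is symmetric about $\mu$: $(\mathbf{Y}^i-\mu)\sim(\mu-\mathbf{Y}^i)$. Let $W$ be an exchangeable resampling weight vector and $\phi:\mathbb{R}^K\to\mathbb{R}$ any subadditive, positive homogeneous function, such that the expectations $\mathbb{E}[\phi(\overline{\mathbf{Y}}-\mu)]$ and $\mathbb{E}[\phi(\overline{\mathbf{Y}}^{\langle W-\overline{W}\rangle})]$ exist. (i) The following general lower bound holds: $$A_W\,\mathbb{E}[\phi(\overline{\mathbf{Y}}-\mu)]\le\mathbb{E}[\phi(\overline{\mathbf{Y}}^{\langle W-\overline{W}\rangle})].$$ (ii) If there are $a>0$ and $x_0\in\mathbb{R}$ such that $|W_i-x_0|=a$ almost surely for all $i$, then, with $D_W:=a+\mathbb{E}|\overline{W}-x_0|$, the following upper bound holds: $$D_W\,\mathbb{E}[\phi(\overline{\mathbf{Y}}-\mu)]\ge\mathbb{E}[\phi(\overline{\mathbf{Y}}^{\langle W-\overline{W}\rangle})].$$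
   Context: $K\ge1$ and $n\ge2$ are integers. $\overline{\mathbf{Y}}=\frac1n\sum_{i=1}^n\mathbf{Y}^i$, and for $w\in\mathbb{R}^n$, $\overline{\mathbf{Y}}^{\langle w\rangle}=\frac1n\sum_{i=1}^nw_i\mathbf{Y}^i$. Subadditive means $\phi(x+x')\le\phi(x)+\phi(x')$; positive homogeneous means $\phi(\lambda x)=\lambda\phi(x)$ for all $\lambda\in\mathbb{R}^+$. A resampling weight vector is an $\mathbb{R}^n$-valued random vector $W=(W_i)_{1\le i\le n}$, independent of $\mathbf{Y}$, with $\mathbb{E}[W_i^2]<\infty$ for all $i$ and $n^{-1}\sum_{i=1}^n\mathbb{E}|W_i-\overline{W}|>0$, where $\overline{W}=\frac1n\sum_{i=1}^nW_i$; it is exchangeable if its distribution is invariant under permutations of the indices. $W-\overline{W}$ denotes $(W_i-\overline{W})_{1\le i\le n}$, and $A_W=\mathbb{E}|W_1-\overline{W}|$. *)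

theory Defs
  imports "HOL-Probability.Probability" "HOL-Combinatorics.Permutations"
begin

definition subadditive_fun :: "('b::real_vector \<Rightarrow> real) \<Rightarrow> bool" where
  "subadditive_fun \<phi> \<longleftrightarrow> (\<forall>x x'. \<phi> (x + x') \<le> \<phi> x + \<phi> x')"

(* Only l > 0 is required; this forces phi 0 = 0 (take x = 0, l = 2), so including
   l = 0 would give the same class of functions. *)
definition pos_homogeneous :: "('b::real_vector \<Rightarrow> real) \<Rightarrow> bool" where
  "pos_homogeneous \<phi> \<longleftrightarrow> (\<forall>l>0. \<forall>x. \<phi> (l *\<^sub>R x) = l * \<phi> x)"

definition weighted_mean :: "nat \<Rightarrow> (nat \<Rightarrow> real) \<Rightarrow> (nat \<Rightarrow> 'b::real_vector) \<Rightarrow> 'b" where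
  "weighted_mean n w y = (1 / real n) *\<^sub>R (\<Sum>i=1..n. w i *\<^sub>R y i)"

definition sample_mean :: "nat \<Rightarrow> (nat \<Rightarrow> 'b::real_vector) \<Rightarrow> 'b" where
  "sample_mean n y = (1 / real n) *\<^sub>R (\<Sum>i=1..n. y i)"

definition centered :: "nat \<Rightarrow> (nat \<Rightarrow> real) \<Rightarrow> nat \<Rightarrow> real" where
  "centered n w i = w i - sample_mean n w"

(* The family X_1, ..., X_n as one random element of the product space. *)
definition joint :: "nat \<Rightarrow> (nat \<Rightarrow> 'a \<Rightarrow> 'b) \<Rightarrow> 'a \<Rightarrow> nat \<Rightarrow> 'b" where
  "joint n X \<omega> = (\<lambda>i\<in>{1..n}. X i \<omega>)"

abbreviation borel_product :: "nat \<Rightarrow> (nat \<Rightarrow> 'b::topological_space) measure" where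
  "borel_product n \<equiv> PiM {1..n} (\<lambda>_. borel)"

(* prob_space.indep_var requires both variables to have the same type; this is the
   right-hand side of the library's prob_space.indep_var_eq at two different types. *)
definition indep_rv ::
    "'a measure \<Rightarrow> 'b measure \<Rightarrow> ('a \<Rightarrow> 'b) \<Rightarrow> 'c measure \<Rightarrow> ('a \<Rightarrow> 'c) \<Rightarrow> bool" where
  "indep_rv M S X T Z \<longleftrightarrow>
     X \<in> measurable M S \<and> Z \<in> measurable M T \<and>
     prob_space.indep_set M
       (sigma_sets (space M) {X -` A \<inter> space M | A. A \<in> sets S})
       (sigma_sets (space M) {Z -` A \<inter> space M | A. A \<in> sets T})"

definition iid_sample ::
    "'a measure \<Rightarrow> nat \<Rightarrow> (nat \<Rightarrow> 'a \<Rightarrow> 'b::topological_space) \<Rightarrow> bool" where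
  "iid_sample M n Y \<longleftrightarrow>
     prob_space.indep_vars M (\<lambda>_. borel) Y {1..n} \<and>
     (\<forall>i\<in>{1..n}. \<forall>j\<in>{1..n}. distr M borel (Y i) = distr M borel (Y j))"

definition symmetric_about ::
    "'a measure \<Rightarrow> ('a \<Rightarrow> 'b::real_normed_vector) \<Rightarrow> 'b \<Rightarrow> bool" where
  "symmetric_about M X \<mu> \<longleftrightarrow>
     distr M borel (\<lambda>\<omega>. X \<omega> - \<mu>) = distr M borel (\<lambda>\<omega>. \<mu> - X \<omega>)"

definition resampling_weight_vector ::
    "'a measure \<Rightarrow> nat \<Rightarrow> (nat \<Rightarrow> 'a \<Rightarrow> 'b::topological_space) \<Rightarrow> (nat \<Rightarrow> 'a \<Rightarrow> real) \<Rightarrow> bool" where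
  "resampling_weight_vector M n Y W \<longleftrightarrow>
     (\<forall>i\<in>{1..n}. W i \<in> borel_measurable M) \<and>
     indep_rv M (borel_product n) (joint n W) (borel_product n) (joint n Y) \<and>
     (\<forall>i\<in>{1..n}. integrable M (\<lambda>\<omega>. (W i \<omega>)\<^sup>2)) \<and>
     (1 / real n) * (\<Sum>i=1..n. \<integral>\<omega>. \<bar>centered n (\<lambda>j. W j \<omega>) i\<bar> \<partial>M) > 0"

definition exchangeable :: "'a measure \<Rightarrow> nat \<Rightarrow> (nat \<Rightarrow> 'a \<Rightarrow> real) \<Rightarrow> bool" where
  "exchangeable M n W \<longleftrightarrow>
     (\<forall>\<pi>. \<pi> permutes {1..n} \<longrightarrow>
        distr M (borel_product n) (joint n (\<lambda>i. W (\<pi> i))) =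
        distr M (borel_product n) (joint n W))"

definition A_W :: "'a measure \<Rightarrow> nat \<Rightarrow> (nat \<Rightarrow> 'a \<Rightarrow> real) \<Rightarrow> real" where
  "A_W M n W = (\<integral>\<omega>. \<bar>W 1 \<omega> - sample_mean n (\<lambda>j. W j \<omega>)\<bar> \<partial>M)"

definition D_W :: "'a measure \<Rightarrow> nat \<Rightarrow> (nat \<Rightarrow> 'a \<Rightarrow> real) \<Rightarrow> real \<Rightarrow> real \<Rightarrow> real" where
  "D_W M n W a x0 = a + (\<integral>\<omega>. \<bar>sample_mean n (\<lambda>j. W j \<omega>) - x0\<bar> \<partial>M)"

end

theory Submission
  imports Defs
begin

text \<open>
  Put \<open>Z i = Y i - \<mu>\<close>.  Since the centered weights sum to zero, replacing \<open>Y\<close> by \<open>Z\<close> does not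
  change the resampled mean.  Because \<open>W\<close> and \<open>Y\<close> are independent, both claims can be
  integrated from statements about deterministic weights \<open>w\<close>, that is, about the function
  \<open>phi_mean w\<close>, the expectation of \<open>\<phi>\<close> at the \<open>w\<close>-weighted mean of the \<open>Z i\<close>
  (\<open>indep_rv_integral\<close>).

  The function \<open>phi_mean\<close> inherits subadditivity and positive homogeneity from \<open>\<phi>\<close>.  Moreover, the
  \<open>Z i\<close> are i.i.d. and symmetric, so permuting them or flipping some of their signs does not
  change their joint law (\<open>distr_joint_signed_permutation\<close>); hence \<open>phi_mean\<close> is invariant under
  permutations and sign changes of the weights, and \<open>phi_mean w\<close> depends only on the multiset of
  the \<open>\<bar>w i\<bar>\<close>.  With \<open>1\<close> the constant weight, \<open>phi_mean 1\<close> is the expectation of \<open>\<phi>\<close> at the centered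
  sample mean, and the two bounds follow:

  \<^item> Lower bound.  Averaging \<open>\<bar>w\<bar>\<close> over all permutations yields the constant weight
    equal to the mean of the \<open>\<bar>w i\<bar>\<close>; the average does not increase \<open>phi_mean\<close>, so \<open>phi_mean w\<close> is at least
    that mean times \<open>phi_mean 1\<close> (\<open>phi_mean_ge_mean_abs\<close>).  For the centered \<open>W\<close>, exchangeability makes
    each \<open>\<bar>W i - mean W\<bar>\<close> have expectation \<open>A_W\<close>.

  \<^item> Upper bound.  Split \<open>w - mean w\<close> into \<open>w - x0\<close> and the constant \<open>x0 - mean w\<close>.  If
    \<open>\<bar>w i - x0\<bar> = a\<close> for all \<open>i\<close>, then the first part has the same \<open>phi_mean\<close> as the constant weight
    \<open>a\<close>, and the second contributes \<open>\<bar>x0 - mean w\<bar> * phi_mean 1\<close> (\<open>phi_mean_centered_le\<close>).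

  On a finite-dimensional space a sublinear \<open>\<phi>\<close> is Lipschitz, which settles measurability
  and the integrability behind \<open>phi_mean\<close>.
\<close>

section \<open>Sublinear functionals\<close>

lemma pos_homogeneous_zero:
  assumes "pos_homogeneous \<phi>"
  shows "\<phi> 0 = 0"
proof -
  have "\<phi> (2 *\<^sub>R 0) = 2 * \<phi> 0"
    using assms unfolding pos_homogeneous_def by (metis zero_less_numeral)
  then show ?thesis by simp
qed

lemma pos_homogeneous_nonneg:
  assumes "pos_homogeneous \<phi>" "0 \<le> c"
  shows "\<phi> (c *\<^sub>R x) = c * \<phi> x"
proof (cases "c = 0")
  case True
  then show ?thesis by (simp add: pos_homogeneous_zero[OF assms(1)])
next
  case False
  with assms(2) have "c > 0" by simp
  with assms(1) show ?thesis unfolding pos_homogeneous_def by blast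
qed

lemma subadditive_fun_sum:
  assumes "subadditive_fun \<phi>" "pos_homogeneous \<phi>" "finite A"
  shows "\<phi> (\<Sum>a\<in>A. x a) \<le> (\<Sum>a\<in>A. \<phi> (x a))"
  using assms(3)
proof (induction A)
  case empty
  then show ?case by (simp add: pos_homogeneous_zero assms)
next
  case (insert a A)
  have "\<phi> (x a + (\<Sum>a\<in>A. x a)) \<le> \<phi> (x a) + \<phi> (\<Sum>a\<in>A. x a)"
    using assms(1) by (simp add: subadditive_fun_def)
  with insert show ?case by simp
qed

text \<open>Expand the argument in an orthonormal basis: each coordinate contributes at most its absolute
  value times the value of \<open>\<phi>\<close> at plus or minus a basis vector.\<close>

lemma sublinear_upper_growth:
  fixes \<phi> :: "'b::euclidean_space \<Rightarrow> real"
  assumes "subadditive_fun \<phi>" "pos_homogeneous \<phi>"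
  obtains C where "C \<ge> 0" "\<And>x. \<phi> x \<le> C * norm x"
proof
  define C where "C = (\<Sum>b\<in>Basis. \<bar>\<phi> b\<bar> + \<bar>\<phi> (- b)\<bar>)"
  show "C \<ge> 0" by (simp add: C_def sum_nonneg)
  fix x :: 'b
  have coord: "\<phi> ((x \<bullet> b) *\<^sub>R b) \<le> (\<bar>\<phi> b\<bar> + \<bar>\<phi> (- b)\<bar>) * norm x" if b: "b \<in> Basis" for b
  proof -
    have "\<phi> ((x \<bullet> b) *\<^sub>R b) = \<phi> (\<bar>x \<bullet> b\<bar> *\<^sub>R (if x \<bullet> b \<ge> 0 then b else - b))"
      by (rule arg_cong[where f = \<phi>]) simp
    also have "\<dots> = \<bar>x \<bullet> b\<bar> * \<phi> (if x \<bullet> b \<ge> 0 then b else - b)"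
      by (rule pos_homogeneous_nonneg[OF assms(2)]) simp
    also have "\<dots> \<le> norm x * (\<bar>\<phi> b\<bar> + \<bar>\<phi> (- b)\<bar>)"
    proof -
      have "\<bar>x \<bullet> b\<bar> * \<phi> (if x \<bullet> b \<ge> 0 then b else - b)
          \<le> \<bar>x \<bullet> b\<bar> * (\<bar>\<phi> b\<bar> + \<bar>\<phi> (- b)\<bar>)"
        by (intro mult_left_mono) auto
      also have "\<dots> \<le> norm x * (\<bar>\<phi> b\<bar> + \<bar>\<phi> (- b)\<bar>)"
        using Basis_le_norm[OF b, of x] by (intro mult_right_mono) auto
      finally show ?thesis .
    qed
    finally show ?thesis by (simp add: mult.commute)
  qed
  have "\<phi> x = \<phi> (\<Sum>b\<in>Basis. (x \<bullet> b) *\<^sub>R b)" by (simp add: euclidean_representation)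
  also have "\<dots> \<le> (\<Sum>b\<in>Basis. \<phi> ((x \<bullet> b) *\<^sub>R b))"
    by (rule subadditive_fun_sum[OF assms]) simp
  also have "\<dots> \<le> C * norm x"
    unfolding C_def sum_distrib_right by (rule sum_mono) (rule coord)
  finally show "\<phi> x \<le> C * norm x" .
qed

text \<open>Subadditivity gives \<open>\<phi> x - \<phi> y \<le> \<phi> (x - y)\<close>, so the one-sided growth bound at the
  difference controls the increment, in both directions by exchanging \<open>x\<close> and \<open>y\<close>.\<close>

lemma sublinear_lipschitz:
  fixes \<phi> :: "'b::euclidean_space \<Rightarrow> real"
  assumes "subadditive_fun \<phi>" "pos_homogeneous \<phi>"
  obtains C where "C-lipschitz_on UNIV \<phi>"
proof -
  obtain C where C: "C \<ge> 0" "\<And>x. \<phi> x \<le> C * norm x"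
    using sublinear_upper_growth[OF assms] by blast
  have "\<phi> x - \<phi> y \<le> C * norm (x - y)" for x y
  proof -
    have "\<phi> ((x - y) + y) \<le> \<phi> (x - y) + \<phi> y"
      using assms(1) unfolding subadditive_fun_def by blast
    with C(2)[of "x - y"] show ?thesis by simp
  qed
  then have "\<bar>\<phi> x - \<phi> y\<bar> \<le> C * norm (x - y)" for x y
    by (metis abs_le_iff minus_diff_eq norm_minus_commute)
  with C(1) have "C-lipschitz_on UNIV \<phi>"
    by (intro lipschitz_onI) (auto simp: dist_norm)
  then show thesis by (rule that)
qed

lemma sublinear_borel_measurable:
  fixes \<phi> :: "'b::euclidean_space \<Rightarrow> real"
  assumes "subadditive_fun \<phi>" "pos_homogeneous \<phi>"
  shows "\<phi> \<in> borel_measurable borel"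
proof -
  obtain C where "C-lipschitz_on UNIV \<phi>" using sublinear_lipschitz[OF assms] .
  then show ?thesis
    by (intro borel_measurable_continuous_onI lipschitz_on_continuous_on)
qed

lemma integrable_sublinear:
  fixes \<phi> :: "'b::euclidean_space \<Rightarrow> real"
  assumes "subadditive_fun \<phi>" "pos_homogeneous \<phi>" "integrable M X"
  shows "integrable M (\<lambda>\<omega>. \<phi> (X \<omega>))"
proof -
  obtain C where C: "C-lipschitz_on UNIV \<phi>" using sublinear_lipschitz[OF assms(1,2)] .
  have bound: "\<bar>\<phi> x\<bar> \<le> C * norm x" for x
    using lipschitz_onD[OF C, of x 0] pos_homogeneous_zero[OF assms(2)] by (simp add: dist_norm)
  show ?thesis
  proof (rule Bochner_Integration.integrable_bound)
    show "integrable M (\<lambda>\<omega>. C * norm (X \<omega>))"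
      using assms(3) by simp
    show "(\<lambda>\<omega>. \<phi> (X \<omega>)) \<in> borel_measurable M"
      by (rule measurable_compose[OF borel_measurable_integrable[OF assms(3)]
            sublinear_borel_measurable[OF assms(1,2)]])
    have "norm (\<phi> (X \<omega>)) \<le> norm (C * norm (X \<omega>))" for \<omega>
      using bound[of "X \<omega>"] by simp
    then show "AE \<omega> in M. norm (\<phi> (X \<omega>)) \<le> norm (C * norm (X \<omega>))" by simp
  qed
qed

section \<open>Averaging over permutations\<close>

text \<open>Composing with the transposition of \<open>i\<close> and \<open>j\<close> shows that the sum is the same for every
  index; adding it up over all indices then determines the common value.\<close>

lemma sum_permutations_eval:
  fixes u :: "'i \<Rightarrow> real"
  assumes "finite S" "i \<in> S"
  shows "(\<Sum>\<pi> | \<pi> permutes S. u (\<pi> i)) = fact (card S) * ((\<Sum>j\<in>S. u j) / card S)"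
proof -
  let ?P = "{\<pi>. \<pi> permutes S}"
  have indep: "(\<Sum>\<pi>\<in>?P. u (\<pi> j)) = (\<Sum>\<pi>\<in>?P. u (\<pi> i))" if "j \<in> S" for j
    using sum_permutations_compose_right[OF permutes_swap_id[OF assms(2) that],
        of "\<lambda>\<pi>. u (\<pi> i)"] by simp
  have "card S * (\<Sum>\<pi>\<in>?P. u (\<pi> i)) = (\<Sum>j\<in>S. \<Sum>\<pi>\<in>?P. u (\<pi> j))"
    by (simp add: indep)
  also have "\<dots> = (\<Sum>\<pi>\<in>?P. \<Sum>j\<in>S. u (\<pi> j))" by (rule sum.swap)
  also have "\<dots> = (\<Sum>\<pi>\<in>?P. \<Sum>j\<in>S. u j)"
    by (rule sum.cong) (auto simp: sum.permute[where g = u, unfolded comp_def, symmetric])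
  also have "\<dots> = fact (card S) * (\<Sum>j\<in>S. u j)"
    using card_permutations[OF refl assms(1)] by simp
  finally have "card S * (\<Sum>\<pi>\<in>?P. u (\<pi> i)) = fact (card S) * (\<Sum>j\<in>S. u j)" .
  moreover have "card S \<noteq> 0" using assms by auto
  ultimately show ?thesis by (simp add: nonzero_eq_divide_eq mult.commute)
qed

text \<open>Adding up the functional over all rearrangements of \<open>u\<close> leaves its value unchanged up to
  the number of permutations, by invariance; by subadditivity the total is at least the value at
  the sum of the rearrangements, and that sum is constant on \<open>S\<close>.  For the expectations below, this
  is the form in which Jensen's inequality enters.\<close>

lemma permutation_invariant_sublinear_ge_mean:
  fixes G :: "('i \<Rightarrow> real) \<Rightarrow> real"
  assumes "finite S"
    and sub: "\<And>u v. G (\<lambda>i. u i + v i) \<le> G u + G v"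
    and hom: "\<And>c u. 0 \<le> c \<Longrightarrow> G (\<lambda>i. c * u i) = c * G u"
    and perm: "\<And>\<pi> u. \<pi> permutes S \<Longrightarrow> G (\<lambda>i. u (\<pi> i)) = G u"
    and cong: "\<And>u v. (\<And>i. i \<in> S \<Longrightarrow> u i = v i) \<Longrightarrow> G u = G v"
    and nonneg: "0 \<le> (\<Sum>i\<in>S. u i)"
  shows "(\<Sum>i\<in>S. u i) / card S * G (\<lambda>_. 1) \<le> G u"
proof -
  let ?P = "{\<pi>. \<pi> permutes S}"
  have G0: "G (\<lambda>_. 0) = 0" using hom[of 0 "\<lambda>_. 0"] by simp
  have sum: "G (\<lambda>i. \<Sum>a\<in>A. f a i) \<le> (\<Sum>a\<in>A. G (f a))" if "finite A" for A :: "('i \<Rightarrow> 'i) set" and f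
    using that
  proof induction
    case (insert a A)
    then show ?case using sub[of "f a" "\<lambda>i. \<Sum>a\<in>A. f a i"] by simp
  qed (simp add: G0)
  have "fact (card S) * ((\<Sum>i\<in>S. u i) / card S * G (\<lambda>_. 1))
      = G (\<lambda>i. (fact (card S) * ((\<Sum>i\<in>S. u i) / card S)) * 1)"
    by (subst hom) (use nonneg in auto)
  also have "\<dots> = G (\<lambda>i. \<Sum>\<pi>\<in>?P. u (\<pi> i))"
    by (rule cong) (simp add: sum_permutations_eval[OF assms(1)])
  also have "\<dots> \<le> (\<Sum>\<pi>\<in>?P. G (\<lambda>i. u (\<pi> i)))"
    by (rule sum) (simp add: assms(1) finite_permutations)
  also have "\<dots> = (\<Sum>\<pi>\<in>?P. G u)" by (intro sum.cong) (auto simp: perm)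
  also have "\<dots> = fact (card S) * G u"
    using card_permutations[OF refl assms(1)] by simp
  finally show ?thesis by (rule mult_left_le_imp_le) simp
qed

section \<open>Independence and symmetry as equalities of laws\<close>

lemma (in prob_space) indep_rv_distr_pair:
  assumes "indep_rv M S X T Z"
  shows "distr M (S \<Otimes>\<^sub>M T) (\<lambda>\<omega>. (X \<omega>, Z \<omega>)) = distr M S X \<Otimes>\<^sub>M distr M T Z"
proof (rule sym, rule pair_measure_eqI)
  have [measurable]: "X \<in> measurable M S" "Z \<in> measurable M T"
    and ind: "indep_set (sigma_sets (space M) {X -` A \<inter> space M | A. A \<in> sets S})
       (sigma_sets (space M) {Z -` A \<inter> space M | A. A \<in> sets T})"
    using assms by (auto simp: indep_rv_def)
  show "sigma_finite_measure (distr M S X)" "sigma_finite_measure (distr M T Z)"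
    by (simp_all add: prob_space_distr prob_space_imp_sigma_finite)
  show "sets (distr M S X \<Otimes>\<^sub>M distr M T Z) = sets (distr M (S \<Otimes>\<^sub>M T) (\<lambda>\<omega>. (X \<omega>, Z \<omega>)))"
    by (simp cong: sets_pair_measure_cong)
  fix A B assume "A \<in> sets (distr M S X)" "B \<in> sets (distr M T Z)"
  then have [measurable]: "A \<in> sets S" "B \<in> sets T" by auto
  have "prob ((X -` A \<inter> space M) \<inter> (Z -` B \<inter> space M))
      = prob (X -` A \<inter> space M) * prob (Z -` B \<inter> space M)"
    by (rule indep_setD[OF ind]) (auto intro!: sigma_sets.Basic)
  moreover have "(\<lambda>\<omega>. (X \<omega>, Z \<omega>)) -` (A \<times> B) \<inter> space M
      = (X -` A \<inter> space M) \<inter> (Z -` B \<inter> space M)" by auto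
  ultimately show "emeasure (distr M S X) A * emeasure (distr M T Z) B
      = emeasure (distr M (S \<Otimes>\<^sub>M T) (\<lambda>\<omega>. (X \<omega>, Z \<omega>))) (A \<times> B)"
    by (simp add: emeasure_distr emeasure_eq_measure ennreal_mult)
qed

text \<open>Fubini's theorem on two copies of the sample space: one carries \<open>X\<close>, the other an
  independent copy of \<open>Z\<close>.\<close>

lemma (in prob_space) indep_rv_integral:
  fixes f :: "'b \<times> 'c \<Rightarrow> real"
  assumes ind: "indep_rv M S X T Z"
    and f[measurable]: "f \<in> borel_measurable (S \<Otimes>\<^sub>M T)"
    and int: "integrable M (\<lambda>\<omega>. f (X \<omega>, Z \<omega>))"
  shows "integrable M (\<lambda>\<omega>. \<integral>\<omega>'. f (X \<omega>, Z \<omega>') \<partial>M)"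
    and "(\<integral>\<omega>. f (X \<omega>, Z \<omega>) \<partial>M) = (\<integral>\<omega>. \<integral>\<omega>'. f (X \<omega>, Z \<omega>') \<partial>M \<partial>M)"
proof -
  interpret MM: pair_sigma_finite M M ..
  have [measurable]: "X \<in> measurable M S" "Z \<in> measurable M T"
    using ind by (auto simp: indep_rv_def)
  have law: "distr M (S \<Otimes>\<^sub>M T) (\<lambda>\<omega>. (X \<omega>, Z \<omega>))
      = distr (M \<Otimes>\<^sub>M M) (S \<Otimes>\<^sub>M T) (\<lambda>(x, y). (X x, Z y))"
    unfolding indep_rv_distr_pair[OF ind]
    by (rule pair_measure_distr) (simp_all add: prob_space_distr prob_space_imp_sigma_finite)
  have int2: "integrable (M \<Otimes>\<^sub>M M) (\<lambda>p. f (X (fst p), Z (snd p)))"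
  proof -
    have "integrable (distr M (S \<Otimes>\<^sub>M T) (\<lambda>\<omega>. (X \<omega>, Z \<omega>))) f"
      using int by (simp add: integrable_distr_eq)
    then show ?thesis
      unfolding law by (simp add: integrable_distr_eq case_prod_beta)
  qed
  show "integrable M (\<lambda>\<omega>. \<integral>\<omega>'. f (X \<omega>, Z \<omega>') \<partial>M)"
    using MM.integrable_fst'[OF int2] by simp
  have "(\<integral>\<omega>. f (X \<omega>, Z \<omega>) \<partial>M) = (\<integral>p. f p \<partial>distr M (S \<Otimes>\<^sub>M T) (\<lambda>\<omega>. (X \<omega>, Z \<omega>)))"
    by (simp add: integral_distr)
  also have "\<dots> = (\<integral>p. f (X (fst p), Z (snd p)) \<partial>(M \<Otimes>\<^sub>M M))"
    unfolding law by (simp add: integral_distr case_prod_beta)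
  also have "\<dots> = (\<integral>\<omega>. \<integral>\<omega>'. f (X \<omega>, Z \<omega>') \<partial>M \<partial>M)"
    using MM.integral_fst'[OF int2] by simp
  finally show "(\<integral>\<omega>. f (X \<omega>, Z \<omega>) \<partial>M) = (\<integral>\<omega>. \<integral>\<omega>'. f (X \<omega>, Z \<omega>') \<partial>M \<partial>M)" .
qed

lemma (in prob_space) indep_vars_reindex:
  assumes ind: "indep_vars N X (f ` I)" and inj: "inj_on f I"
  shows "indep_vars (\<lambda>i. N (f i)) (\<lambda>i. X (f i)) I"
  unfolding indep_vars_def2
proof (intro conjI indep_setsI)
  show "\<forall>i\<in>I. X (f i) \<in> measurable M (N (f i))"
    using ind by (auto simp: indep_vars_def2)
  then show "{X (f i) -` A \<inter> space M |A. A \<in> sets (N (f i))} \<subseteq> events" if "i \<in> I" for i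
    using that by (auto intro: measurable_sets)
next
  fix A J
  assume J: "J \<noteq> {}" "J \<subseteq> I" "finite J"
    and A: "\<forall>j\<in>J. A j \<in> {X (f j) -` A \<inter> space M |A. A \<in> sets (N (f j))}"
  define B where "B = (\<lambda>k. A (inv_into J f k))"
  have inj': "inj_on f J" using inj J(2) by (rule inj_on_subset)
  have B: "B (f j) = A j" if "j \<in> J" for j
    using that inj' by (simp add: B_def)
  have sets: "indep_sets (\<lambda>i. {X i -` A \<inter> space M |A. A \<in> sets (N i)}) (f ` I)"
    using ind by (simp add: indep_vars_def2)
  have "prob (\<Inter>k\<in>f ` J. B k) = (\<Prod>k\<in>f ` J. prob (B k))"
    by (rule indep_setsD[OF sets]) (use J A B in auto)
  moreover have "(\<Inter>k\<in>f ` J. B k) = (\<Inter>j\<in>J. A j)" using B by auto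
  moreover have "(\<Prod>k\<in>f ` J. prob (B k)) = (\<Prod>j\<in>J. prob (A j))"
    by (subst prod.reindex[OF inj']) (simp add: B)
  ultimately show "prob (\<Inter>j\<in>J. A j) = (\<Prod>j\<in>J. prob (A j))" by simp
qed

lemma (in prob_space) distr_joint_indep_vars:
  assumes "indep_vars (\<lambda>_. borel) X {1..n}" "n \<ge> 1"
  shows "distr M (borel_product n) (joint n X) = (\<Pi>\<^sub>M i\<in>{1..n}. distr M borel (X i))"
  using indep_vars_iff_distr_eq_PiM'[where I = "{1..n}" and M' = "\<lambda>_. borel" and X = X] assms
  by (auto simp: joint_def[abs_def] indep_vars_def)

text \<open>Both laws are products of the same marginals: neither a permutation of the
  indices nor a change of sign affects a marginal.\<close>

lemma (in prob_space) distr_joint_signed_permutation: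
  fixes Z :: "nat \<Rightarrow> 'a \<Rightarrow> 'b::euclidean_space"
  assumes iid: "iid_sample M n Z" and n: "n \<ge> 1"
    and symm: "\<And>i. i \<in> {1..n} \<Longrightarrow> symmetric_about M (Z i) 0"
    and perm: "\<pi> permutes {1..n}" and s: "\<And>i. s i = 1 \<or> s i = - 1"
  shows "distr M (borel_product n) (joint n (\<lambda>i \<omega>. s i *\<^sub>R Z (\<pi> i) \<omega>))
    = distr M (borel_product n) (joint n Z)"
proof -
  have ind: "indep_vars (\<lambda>_. borel) Z {1..n}"
    and same: "\<And>i j. i \<in> {1..n} \<Longrightarrow> j \<in> {1..n} \<Longrightarrow> distr M borel (Z i) = distr M borel (Z j)"
    using iid unfolding iid_sample_def by blast+
  have "indep_vars (\<lambda>_. borel) Z (\<pi> ` {1..n})"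
    using ind permutes_image[OF perm] by simp
  from indep_vars_reindex[OF this permutes_inj_on[OF perm]]
  have "indep_vars (\<lambda>_. borel) (\<lambda>i. Z (\<pi> i)) {1..n}" .
  from indep_vars_compose2[OF this, of "\<lambda>i x. s i *\<^sub>R x" "\<lambda>_. borel"]
  have ind': "indep_vars (\<lambda>_. borel) (\<lambda>i \<omega>. s i *\<^sub>R Z (\<pi> i) \<omega>) {1..n}" by simp
  have marg: "distr M borel (\<lambda>\<omega>. s i *\<^sub>R Z (\<pi> i) \<omega>) = distr M borel (Z i)" if i: "i \<in> {1..n}" for i
  proof -
    have pi: "\<pi> i \<in> {1..n}" using permutes_in_image[OF perm] i by blast
    have "distr M borel (\<lambda>\<omega>. s i *\<^sub>R Z (\<pi> i) \<omega>) = distr M borel (Z (\<pi> i))"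
      using s[of i] symm[OF pi] by (auto simp: symmetric_about_def)
    with same[OF pi i] show ?thesis by simp
  qed
  show ?thesis
    unfolding distr_joint_indep_vars[OF ind n] distr_joint_indep_vars[OF ind' n]
    by (rule PiM_cong) (simp_all add: marg)
qed

lemma (in prob_space) iid_sample_diff:
  fixes Y :: "nat \<Rightarrow> 'a \<Rightarrow> 'b::euclidean_space"
  assumes "iid_sample M n Y"
  shows "iid_sample M n (\<lambda>i \<omega>. Y i \<omega> - \<mu>)"
  unfolding iid_sample_def
proof (intro conjI ballI)
  have ind: "indep_vars (\<lambda>_. borel) Y {1..n}" using assms by (simp add: iid_sample_def)
  from indep_vars_compose2[OF this, of "\<lambda>i x. x - \<mu>" "\<lambda>_. borel"]
  show "indep_vars (\<lambda>_. borel) (\<lambda>i \<omega>. Y i \<omega> - \<mu>) {1..n}" by simp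
  fix i j assume ij: "i \<in> {1..n}" "j \<in> {1..n}"
  have rv: "Y k \<in> borel_measurable M" if "k \<in> {1..n}" for k
    using ind that by (simp add: indep_vars_def)
  have shift: "distr M borel (\<lambda>\<omega>. Y k \<omega> - \<mu>) = distr (distr M borel (Y k)) borel (\<lambda>x. x - \<mu>)"
    if "k \<in> {1..n}" for k
    using distr_distr[of "\<lambda>x. x - \<mu>" borel borel "Y k" M] rv[OF that] by (simp add: comp_def)
  have "distr M borel (Y i) = distr M borel (Y j)"
    using assms ij unfolding iid_sample_def by blast
  then show "distr M borel (\<lambda>\<omega>. Y i \<omega> - \<mu>) = distr M borel (\<lambda>\<omega>. Y j \<omega> - \<mu>)"
    by (simp only: shift[OF ij(1)] shift[OF ij(2)])
qed

lemma measurable_joint: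
  assumes "\<And>i. i \<in> {1..n} \<Longrightarrow> X i \<in> borel_measurable M"
  shows "joint n X \<in> measurable M (borel_product n)"
  unfolding joint_def[abs_def] by (rule measurable_restrict) (rule assms)

section \<open>Weighted means\<close>

lemma weighted_mean_cong:
  "(\<And>i. i \<in> {1..n} \<Longrightarrow> w i = w' i) \<Longrightarrow> (\<And>i. i \<in> {1..n} \<Longrightarrow> y i = y' i)
    \<Longrightarrow> weighted_mean n w y = weighted_mean n w' y'"
  by (simp add: weighted_mean_def)

lemma weighted_mean_add:
  "weighted_mean n (\<lambda>i. u i + v i) y = weighted_mean n u y + weighted_mean n v y"
  by (simp add: weighted_mean_def scaleR_add_left sum.distrib scaleR_add_right)

lemma weighted_mean_scale:
  "weighted_mean n (\<lambda>i. c * u i) y = c *\<^sub>R weighted_mean n u y"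
  by (simp add: weighted_mean_def scaleR_sum_right mult.left_commute)

lemma weighted_mean_signed_permutation:
  assumes "\<pi> permutes {1..n}"
  shows "weighted_mean n w (\<lambda>i. s (inv \<pi> i) *\<^sub>R y (inv \<pi> i))
    = weighted_mean n (\<lambda>i. s i * w (\<pi> i)) y"
  unfolding weighted_mean_def
  by (subst sum.permute[OF assms])
     (simp add: comp_def permutes_inverses[OF assms] mult.commute)

lemma weighted_mean_1: "weighted_mean n (\<lambda>_. 1) y = sample_mean n y"
  by (simp add: weighted_mean_def sample_mean_def)

lemma sample_mean_diff:
  assumes "n \<ge> 1"
  shows "sample_mean n (\<lambda>i. y i - c) = sample_mean n y - c"
  using assms by (simp add: sample_mean_def sum_subtractf scaleR_diff_right sum_constant_scaleR)

lemma centered_cong: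
  assumes "\<And>i. i \<in> {1..n} \<Longrightarrow> w i = w' i" "i \<in> {1..n}"
  shows "centered n w i = centered n w' i"
  using assms by (simp add: centered_def sample_mean_def)

lemma sum_centered:
  assumes "n \<ge> 1"
  shows "(\<Sum>i=1..n. centered n w i) = 0"
  using assms by (simp add: centered_def sum_subtractf sample_mean_def)

lemma weighted_mean_centered_diff:
  assumes "n \<ge> 1"
  shows "weighted_mean n (centered n w) (\<lambda>i. y i - c) = weighted_mean n (centered n w) y"
proof -
  have "(\<Sum>i=1..n. centered n w i *\<^sub>R (y i - c))
      = (\<Sum>i=1..n. centered n w i *\<^sub>R y i) - (\<Sum>i=1..n. centered n w i) *\<^sub>R c"
    by (simp add: scaleR_diff_right sum_subtractf scaleR_sum_left)
  then show ?thesis unfolding weighted_mean_def sum_centered[OF assms] by simp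
qed

lemma centered_permute:
  assumes "\<pi> permutes {1..n}"
  shows "centered n (\<lambda>i. w (\<pi> i)) i = centered n w (\<pi> i)"
  using sum.permute[OF assms, of w] by (simp add: centered_def sample_mean_def comp_def)

text \<open>The transposition of \<open>1\<close> and \<open>i\<close> preserves the joint law of the weights and their mean, and
  moves the first centered weight to the \<open>i\<close>-th.\<close>

lemma exchangeable_integral_abs_centered:
  assumes meas: "\<And>i. i \<in> {1..n} \<Longrightarrow> W i \<in> borel_measurable M"
    and exch: "exchangeable M n W" and i: "i \<in> {1..n}"
  shows "(\<integral>\<omega>. \<bar>centered n (\<lambda>j. W j \<omega>) i\<bar> \<partial>M) = A_W M n W"
proof -
  define h :: "(nat \<Rightarrow> real) \<Rightarrow> real" where "h = (\<lambda>w. \<bar>centered n w 1\<bar>)"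
  have one: "1 \<in> {1..n}" using i by simp
  have h_meas: "h \<in> borel_measurable (borel_product n)"
    unfolding h_def centered_def sample_mean_def
    by (intro borel_measurable_abs borel_measurable_diff borel_measurable_scaleR
        borel_measurable_sum borel_measurable_const measurable_component_singleton one)
  have law: "(\<integral>\<omega>. h (joint n V \<omega>) \<partial>M) = (\<integral>w. h w \<partial>distr M (borel_product n) (joint n V))"
    if "\<And>i. i \<in> {1..n} \<Longrightarrow> V i \<in> borel_measurable M" for V
    by (rule integral_distr[OF measurable_joint[OF that] h_meas, symmetric])
  have h: "h (joint n V \<omega>) = \<bar>centered n (\<lambda>j. V j \<omega>) 1\<bar>" for V \<omega>
    unfolding h_def
    by (intro arg_cong[where f = abs] centered_cong one) (simp add: joint_def)
  let ?\<pi> = "Transposition.transpose 1 i"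
  have \<pi>: "?\<pi> permutes {1..n}" by (rule permutes_swap_id) (use one i in auto)
  have "(\<integral>\<omega>. \<bar>centered n (\<lambda>j. W j \<omega>) i\<bar> \<partial>M) = (\<integral>\<omega>. h (joint n (\<lambda>i. W (?\<pi> i)) \<omega>) \<partial>M)"
    unfolding h centered_permute[OF \<pi>, of "\<lambda>j. W j _"] by simp
  also have "\<dots> = (\<integral>w. h w \<partial>distr M (borel_product n) (joint n (\<lambda>i. W (?\<pi> i))))"
    by (rule law, rule meas) (simp only: permutes_in_image[OF \<pi>])
  also have "\<dots> = (\<integral>w. h w \<partial>distr M (borel_product n) (joint n W))"
    using exch \<pi> unfolding exchangeable_def by metis
  also have "\<dots> = (\<integral>\<omega>. h (joint n W \<omega>) \<partial>M)"
    by (rule law[symmetric]) (rule meas)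
  also have "\<dots> = A_W M n W" unfolding h by (simp add: A_W_def centered_def)
  finally show ?thesis .
qed

section \<open>Deterministic weights\<close>

locale symmetric_sublinear_sample = prob_space M
  for M :: "'a measure" +
  fixes n :: nat and Z :: "nat \<Rightarrow> 'a \<Rightarrow> 'b::euclidean_space" and \<phi> :: "'b \<Rightarrow> real"
  assumes n: "n \<ge> 1"
    and iid: "iid_sample M n Z"
    and integrable_Z: "\<And>i. i \<in> {1..n} \<Longrightarrow> integrable M (Z i)"
    and symmetric_Z: "\<And>i. i \<in> {1..n} \<Longrightarrow> symmetric_about M (Z i) 0"
    and subadditive: "subadditive_fun \<phi>"
    and homogeneous: "pos_homogeneous \<phi>"
begin

definition phi_mean :: "(nat \<Rightarrow> real) \<Rightarrow> real" where
  "phi_mean w = (\<integral>\<omega>. \<phi> (weighted_mean n w (\<lambda>i. Z i \<omega>)) \<partial>M)"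

lemma integrable_weighted_mean: "integrable M (\<lambda>\<omega>. \<phi> (weighted_mean n w (\<lambda>i. Z i \<omega>)))"
proof (rule integrable_sublinear[OF subadditive homogeneous])
  have "integrable M (\<lambda>\<omega>. \<Sum>i=1..n. w i *\<^sub>R Z i \<omega>)"
    by (rule Bochner_Integration.integrable_sum) (simp add: integrable_Z)
  then show "integrable M (\<lambda>\<omega>. weighted_mean n w (\<lambda>i. Z i \<omega>))"
    unfolding weighted_mean_def by simp
qed

lemma phi_mean_cong:
  assumes "\<And>i. i \<in> {1..n} \<Longrightarrow> u i = v i"
  shows "phi_mean u = phi_mean v"
proof -
  have "weighted_mean n u y = weighted_mean n v y" for y :: "nat \<Rightarrow> 'b"
    by (simp add: weighted_mean_def assms)
  then show ?thesis by (simp add: phi_mean_def)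
qed

lemma phi_mean_add: "phi_mean (\<lambda>i. u i + v i) \<le> phi_mean u + phi_mean v"
proof -
  have "phi_mean (\<lambda>i. u i + v i)
      \<le> (\<integral>\<omega>. \<phi> (weighted_mean n u (\<lambda>i. Z i \<omega>)) + \<phi> (weighted_mean n v (\<lambda>i. Z i \<omega>)) \<partial>M)"
    unfolding phi_mean_def
    by (intro integral_mono integrable_weighted_mean Bochner_Integration.integrable_add)
       (use subadditive in \<open>simp add: weighted_mean_add subadditive_fun_def\<close>)
  also have "\<dots> = phi_mean u + phi_mean v"
    unfolding phi_mean_def by (intro Bochner_Integration.integral_add integrable_weighted_mean)
  finally show ?thesis .
qed

lemma phi_mean_scale: "0 \<le> c \<Longrightarrow> phi_mean (\<lambda>i. c * u i) = c * phi_mean u"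
  by (simp add: phi_mean_def weighted_mean_scale pos_homogeneous_nonneg[OF homogeneous])

text \<open>The signs and the permutation are moved from the weights to the sample, where the permutation
  becomes its inverse and the signs are carried along; this leaves the law of the sample
  unchanged.\<close>

lemma phi_mean_signed_permutation:
  assumes perm: "\<pi> permutes {1..n}" and s: "\<And>i. s i = 1 \<or> s i = - 1"
  shows "phi_mean (\<lambda>i. s i * w (\<pi> i)) = phi_mean w"
proof -
  let ?Z' = "\<lambda>i \<omega>. s (inv \<pi> i) *\<^sub>R Z (inv \<pi> i) \<omega>"
  have inv: "inv \<pi> permutes {1..n}" using perm by (rule permutes_inv)
  have rv: "Z i \<in> borel_measurable M" if "i \<in> {1..n}" for i
    using integrable_Z[OF that] by simp
  have rv': "?Z' i \<in> borel_measurable M" if "i \<in> {1..n}" for i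
    using that permutes_in_image[OF inv] by (intro borel_measurable_scaleR rv) auto
  have law: "(\<integral>\<omega>. \<phi> (weighted_mean n w (\<lambda>i. V i \<omega>)) \<partial>M)
      = (\<integral>y. \<phi> (weighted_mean n w y) \<partial>distr M (borel_product n) (joint n V))"
    if V: "\<And>i. i \<in> {1..n} \<Longrightarrow> V i \<in> borel_measurable M" for V
  proof (subst integral_distr)
    show "joint n V \<in> measurable M (borel_product n)"
      by (rule measurable_joint) (rule V)
    have "\<phi> \<in> borel_measurable borel"
      by (rule sublinear_borel_measurable[OF subadditive homogeneous])
    show "(\<lambda>y. \<phi> (weighted_mean n w y)) \<in> borel_measurable (borel_product n)"
      by (rule measurable_compose[OF _ \<open>\<phi> \<in> borel_measurable borel\<close>], unfold weighted_mean_def)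
         (intro borel_measurable_scaleR borel_measurable_sum borel_measurable_const
            measurable_component_singleton)
    have "weighted_mean n w (joint n V \<omega>) = weighted_mean n w (\<lambda>i. V i \<omega>)" for \<omega>
      by (rule weighted_mean_cong) (simp_all add: joint_def)
    then show "(\<integral>\<omega>. \<phi> (weighted_mean n w (\<lambda>i. V i \<omega>)) \<partial>M)
        = (\<integral>\<omega>. \<phi> (weighted_mean n w (joint n V \<omega>)) \<partial>M)" by simp
  qed
  have "phi_mean w = (\<integral>y. \<phi> (weighted_mean n w y) \<partial>distr M (borel_product n) (joint n Z))"
    unfolding phi_mean_def by (rule law) (rule rv)
  also have "\<dots> = (\<integral>y. \<phi> (weighted_mean n w y) \<partial>distr M (borel_product n) (joint n ?Z'))"
    using distr_joint_signed_permutation[OF iid n symmetric_Z inv, of "\<lambda>i. s (inv \<pi> i)"] s by simp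
  also have "\<dots> = (\<integral>\<omega>. \<phi> (weighted_mean n w (\<lambda>i. ?Z' i \<omega>)) \<partial>M)"
    by (rule law[symmetric]) (rule rv')
  also have "\<dots> = phi_mean (\<lambda>i. s i * w (\<pi> i))"
    unfolding phi_mean_def
    by (simp add: weighted_mean_signed_permutation[OF perm, of w s "\<lambda>i. Z i _"])
  finally show ?thesis by simp
qed

lemma phi_mean_permutation: "\<pi> permutes {1..n} \<Longrightarrow> phi_mean (\<lambda>i. w (\<pi> i)) = phi_mean w"
  using phi_mean_signed_permutation[of \<pi> "\<lambda>_. 1" w] by simp

lemma phi_mean_abs: "phi_mean (\<lambda>i. \<bar>w i\<bar>) = phi_mean w"
proof -
  have "phi_mean (\<lambda>i. (if w i < 0 then - 1 else 1) * w (id i)) = phi_mean w"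
    by (rule phi_mean_signed_permutation[OF permutes_id]) simp
  moreover have "(\<lambda>i. (if w i < 0 then - 1 else 1) * w (id i)) = (\<lambda>i. \<bar>w i\<bar>)" by auto
  ultimately show ?thesis by simp
qed

lemma phi_mean_const: "phi_mean (\<lambda>_. c) = \<bar>c\<bar> * phi_mean (\<lambda>_. 1)"
  using phi_mean_abs[of "\<lambda>_. c"] phi_mean_scale[of "\<bar>c\<bar>" "\<lambda>_. 1"] by simp

lemma phi_mean_ge_mean_abs: "(\<Sum>i=1..n. \<bar>w i\<bar>) / n * phi_mean (\<lambda>_. 1) \<le> phi_mean w"
proof -
  have "(\<Sum>i\<in>{1..n}. \<bar>w i\<bar>) / card {1..n} * phi_mean (\<lambda>_. 1) \<le> phi_mean (\<lambda>i. \<bar>w i\<bar>)"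
  proof (rule permutation_invariant_sublinear_ge_mean)
    show "phi_mean (\<lambda>i. u (\<pi> i)) = phi_mean u" if "\<pi> permutes {1..n}" for u \<pi>
      using that by (rule phi_mean_permutation)
  qed (auto intro: phi_mean_add phi_mean_scale phi_mean_cong sum_nonneg)
  then show ?thesis by (simp add: phi_mean_abs)
qed

text \<open>The deviations \<open>w i - x\<close> differ from the constant \<open>a\<close> only in their signs, which the
  functional ignores.\<close>

lemma phi_mean_centered_le:
  assumes "0 \<le> a" and abs: "\<And>i. i \<in> {1..n} \<Longrightarrow> \<bar>w i - x\<bar> = a"
  shows "phi_mean (centered n w) \<le> (a + \<bar>sample_mean n w - x\<bar>) * phi_mean (\<lambda>_. 1)"
proof -
  have "phi_mean (centered n w) = phi_mean (\<lambda>i. (w i - x) + (x - sample_mean n w))"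
    by (rule phi_mean_cong) (simp add: centered_def)
  also have "\<dots> \<le> phi_mean (\<lambda>i. w i - x) + phi_mean (\<lambda>_. x - sample_mean n w)"
    by (rule phi_mean_add)
  also have "phi_mean (\<lambda>i. w i - x) = phi_mean (\<lambda>i. \<bar>w i - x\<bar>)" by (rule phi_mean_abs[symmetric])
  also have "\<dots> = phi_mean (\<lambda>_. a)" by (rule phi_mean_cong) (rule abs)
  finally show ?thesis
    using \<open>0 \<le> a\<close> by (simp add: phi_mean_const[of a] phi_mean_const[of "x - sample_mean n w"]
        abs_minus_commute distrib_right)
qed

end

section \<open>Random weights\<close>

theorem proposition2p4:
  fixes M :: "'a measure"
    and n :: nat
    and Y :: "nat \<Rightarrow> 'a \<Rightarrow> real ^ 'k"
    and \<mu> :: "real ^ 'k"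
    and W :: "nat \<Rightarrow> 'a \<Rightarrow> real"
    and \<phi> :: "real ^ 'k \<Rightarrow> real"
  assumes "prob_space M"
    and "n \<ge> 2"
    and "iid_sample M n Y"
    and "\<And>i. i \<in> {1..n} \<Longrightarrow> integrable M (Y i)"
    and "\<And>i. i \<in> {1..n} \<Longrightarrow> (\<integral>\<omega>. Y i \<omega> \<partial>M) = \<mu>"
    and "\<And>i. i \<in> {1..n} \<Longrightarrow> symmetric_about M (Y i) \<mu>"
    and "resampling_weight_vector M n Y W"
    and "exchangeable M n W"
    and "subadditive_fun \<phi>"
    and "pos_homogeneous \<phi>"
    and "integrable M (\<lambda>\<omega>. \<phi> (sample_mean n (\<lambda>i. Y i \<omega>) - \<mu>))"
    and "integrable M (\<lambda>\<omega>. \<phi> (weighted_mean n (centered n (\<lambda>i. W i \<omega>)) (\<lambda>i. Y i \<omega>)))"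
  shows "A_W M n W * (\<integral>\<omega>. \<phi> (sample_mean n (\<lambda>i. Y i \<omega>) - \<mu>) \<partial>M)
           \<le> (\<integral>\<omega>. \<phi> (weighted_mean n (centered n (\<lambda>i. W i \<omega>)) (\<lambda>i. Y i \<omega>)) \<partial>M)
       \<and> (\<forall>a x0. a > 0 \<longrightarrow> (\<forall>i\<in>{1..n}. AE \<omega> in M. \<bar>W i \<omega> - x0\<bar> = a) \<longrightarrow>
           D_W M n W a x0 * (\<integral>\<omega>. \<phi> (sample_mean n (\<lambda>i. Y i \<omega>) - \<mu>) \<partial>M)
           \<ge> (\<integral>\<omega>. \<phi> (weighted_mean n (centered n (\<lambda>i. W i \<omega>)) (\<lambda>i. Y i \<omega>)) \<partial>M))"
proof -
  interpret prob_space M by fact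
  define Z where "Z = (\<lambda>i \<omega>. Y i \<omega> - \<mu>)"
  have n1: "n \<ge> 1" using \<open>n \<ge> 2\<close> by simp
  interpret symmetric_sublinear_sample M n Z \<phi>
  proof
    show "n \<ge> 1" by (rule n1)
    show "iid_sample M n Z" unfolding Z_def by (rule iid_sample_diff) fact
    show "subadditive_fun \<phi>" "pos_homogeneous \<phi>" by fact+
    fix i assume i: "i \<in> {1..n}"
    show "integrable M (Z i)" unfolding Z_def using assms(4)[OF i] by simp
    show "symmetric_about M (Z i) 0"
      using assms(6)[OF i] by (simp add: Z_def symmetric_about_def)
  qed
  have W: "\<And>i. i \<in> {1..n} \<Longrightarrow> W i \<in> borel_measurable M"
    and ind: "indep_rv M (borel_product n) (joint n W) (borel_product n) (joint n Y)"
    and W2: "\<And>i. i \<in> {1..n} \<Longrightarrow> integrable M (\<lambda>\<omega>. (W i \<omega>)\<^sup>2)"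
    using assms(7) by (auto simp: resampling_weight_vector_def)
  have intW: "integrable M (W i)" if "i \<in> {1..n}" for i
    using square_integrable_imp_integrable[OF W W2] that by blast
  have int_mean: "integrable M (\<lambda>\<omega>. sample_mean n (\<lambda>j. W j \<omega>))"
  proof -
    have "integrable M (\<lambda>\<omega>. \<Sum>i=1..n. W i \<omega>)"
      by (rule Bochner_Integration.integrable_sum) (rule intW)
    then show ?thesis unfolding sample_mean_def by simp
  qed
  have int_cent: "integrable M (\<lambda>\<omega>. centered n (\<lambda>j. W j \<omega>) i)" if "i \<in> {1..n}" for i
    unfolding centered_def by (rule Bochner_Integration.integrable_diff[OF intW[OF that] int_mean])

  have mean: "(\<integral>\<omega>. \<phi> (sample_mean n (\<lambda>i. Y i \<omega>) - \<mu>) \<partial>M) = phi_mean (\<lambda>_. 1)"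
    unfolding phi_mean_def weighted_mean_1 by (simp add: Z_def sample_mean_diff[OF n1])

  \<comment> \<open>The resampled quantity as a function of the weights and the sample: integrating out the
    sample for fixed weights gives the deterministic functional.\<close>
  define f where "f = (\<lambda>(w, y). \<phi> (weighted_mean n (centered n w) y))"
  have f_meas: "f \<in> borel_measurable (borel_product n \<Otimes>\<^sub>M borel_product n)"
  proof -
    have \<phi>: "\<phi> \<in> borel_measurable borel"
      by (rule sublinear_borel_measurable) fact+
    show ?thesis
      unfolding f_def split_def
      by (rule measurable_compose[OF _ \<phi>],
          unfold weighted_mean_def centered_def sample_mean_def)
         (intro borel_measurable_scaleR borel_measurable_sum borel_measurable_diff
            borel_measurable_const
            measurable_compose[OF measurable_fst measurable_component_singleton]
            measurable_compose[OF measurable_snd measurable_component_singleton])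
  qed
  have f: "f (joint n W \<omega>, joint n Y \<omega>')
      = \<phi> (weighted_mean n (centered n (\<lambda>i. W i \<omega>)) (\<lambda>i. Y i \<omega>'))" for \<omega> \<omega>'
    unfolding f_def prod.case
    by (intro arg_cong[where f = \<phi>] weighted_mean_cong centered_cong) (auto simp: joint_def)
  have phi_mean_eq: "(\<integral>\<omega>'. f (joint n W \<omega>, joint n Y \<omega>') \<partial>M) = phi_mean (centered n (\<lambda>i. W i \<omega>))" for \<omega>
    unfolding f phi_mean_def by (simp add: Z_def weighted_mean_centered_diff[OF n1])
  have int_f: "integrable M (\<lambda>\<omega>. f (joint n W \<omega>, joint n Y \<omega>))"
    unfolding f by (rule assms(12))
  note decouple = indep_rv_integral[OF ind f_meas int_f, unfolded phi_mean_eq, unfolded f]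

  have "A_W M n W * phi_mean (\<lambda>_. 1)
      = (\<integral>\<omega>. (\<Sum>i=1..n. \<bar>centered n (\<lambda>j. W j \<omega>) i\<bar>) / n * phi_mean (\<lambda>_. 1) \<partial>M)"
  proof -
    have "(\<integral>\<omega>. (\<Sum>i=1..n. \<bar>centered n (\<lambda>j. W j \<omega>) i\<bar>) \<partial>M)
        = (\<Sum>i=1..n. \<integral>\<omega>. \<bar>centered n (\<lambda>j. W j \<omega>) i\<bar> \<partial>M)"
      by (intro Bochner_Integration.integral_sum integrable_abs int_cent)
    also have "\<dots> = (\<Sum>i=1..n. A_W M n W)"
      by (intro sum.cong refl exchangeable_integral_abs_centered W) (use assms(8) in auto)
    finally show ?thesis using n1 by simp
  qed
  also have "\<dots> \<le> (\<integral>\<omega>. phi_mean (centered n (\<lambda>i. W i \<omega>)) \<partial>M)"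
    by (intro integral_mono decouple(1) phi_mean_ge_mean_abs integrable_mult_left integrable_divide
        Bochner_Integration.integrable_sum integrable_abs int_cent)
  finally have lower: "A_W M n W * phi_mean (\<lambda>_. 1)
      \<le> (\<integral>\<omega>. \<phi> (weighted_mean n (centered n (\<lambda>i. W i \<omega>)) (\<lambda>i. Y i \<omega>)) \<partial>M)"
    by (simp add: decouple(2))

  have upper: "(\<integral>\<omega>. \<phi> (weighted_mean n (centered n (\<lambda>i. W i \<omega>)) (\<lambda>i. Y i \<omega>)) \<partial>M)
      \<le> D_W M n W a x0 * phi_mean (\<lambda>_. 1)"
    if a: "a > 0" and abs: "\<forall>i\<in>{1..n}. AE \<omega> in M. \<bar>W i \<omega> - x0\<bar> = a" for a x0
  proof -
    have int_D: "integrable M (\<lambda>\<omega>. \<bar>sample_mean n (\<lambda>i. W i \<omega>) - x0\<bar>)"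
      by (intro integrable_abs Bochner_Integration.integrable_diff int_mean integrable_const)
    have "AE \<omega> in M. \<forall>i\<in>{1..n}. \<bar>W i \<omega> - x0\<bar> = a"
      using abs by (subst AE_finite_all) auto
    then have "AE \<omega> in M. phi_mean (centered n (\<lambda>i. W i \<omega>))
        \<le> (a + \<bar>sample_mean n (\<lambda>i. W i \<omega>) - x0\<bar>) * phi_mean (\<lambda>_. 1)"
      by eventually_elim (rule phi_mean_centered_le, use a in auto)
    then have "(\<integral>\<omega>. phi_mean (centered n (\<lambda>i. W i \<omega>)) \<partial>M)
        \<le> (\<integral>\<omega>. (a + \<bar>sample_mean n (\<lambda>i. W i \<omega>) - x0\<bar>) * phi_mean (\<lambda>_. 1) \<partial>M)"
      by (intro integral_mono_AE decouple(1) integrable_mult_left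
          Bochner_Integration.integrable_add integrable_const int_D)
    also have "\<dots> = D_W M n W a x0 * phi_mean (\<lambda>_. 1)"
      using int_D by (simp add: D_W_def prob_space)
    finally show ?thesis by (simp add: decouple(2))
  qed
  show ?thesis unfolding mean using lower upper by blast
qed

end
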